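(* Let $\mathcal P=\langle X\mid \omega:R\to F(X)\rangle$ be a presentation of a group $G$, with canonical epimorphism $\varphi:F(X)\to G$, free crossed module $\delta_2:C(R)\to F(X)$ on $\omega$, and module of identities among relations $\pi(\mathcal P)=\ker\delta_2$. Let $\sigma:G\to F(X)$ be a section of $\varphi$ (a function with $\varphi\sigma=1_G$). Let $F(\widetilde X)$ be the free groupoid on the Cayley graph $\widetilde X$ of the presentation, and let $k_1:F(\widetilde X)\to C(R)$ be a morphism of groupoids (where the group $C(R)$ is regarded as a groupoid with one object) such that $$\delta_2k_1(g,x)=(\sigma g)\,x\,(\sigma(g(\varphi x)))^{-1}\qquad\text{for all } x\in X,\ g\in G.$$ Then $\pi(\mathcal P)$ is generated as a $G$-module by the elements $$\delta_3[g,r]=(k_1(g,\omega r))^{-1}\; r^{(\sigma g)^{-1}}\qquad (g\in G,\ r\in R).$$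
   Context: $F(X)$ is the free group on the set $X$. A presentation $\langle X\mid\omega:R\to F(X)\rangle$ of $G$ consists of a set $X$, a set $R$, a function $\omega:R\to F(X)$, and an epimorphism $\varphi:F(X)\to G$ whose kernel is the normal closure of $\omega(R)$. A crossed module over a group $F$ is a group homomorphism $\mu:M\to F$ with a right action $(m,u)\mapsto m^u$ of $F$ on $M$ by automorphisms such that $\mu(m^u)=u^{-1}\mu(m)u$ and $n^{-1}mn=m^{\mu n}$ for $m,n\in M$, $u\in F$. The free crossed module $\delta_2:C(R)\to F(X)$ on $\omega$ is the crossed $F(X)$-module with a function $R\to C(R)$ (written $r\mapsto r$) satisfying $\delta_2(r)=\omega(r)$, universal among crossed $F(X)$-modules $\mu:M\to F(X)$ equipped with a function $f:R\to M$ with $\mu f=\omega$. Its kernel $\pi(\mathcal P)$ is central in $C(R)$, and the action of $F(X)$ on $\pi(\mathcal P)$ factors through $\varphi$, making $\pi(\mathcal P)$ a (right) $G$-module. In a groupoid, the composite of $a:x\to y$ and $b:y\to z$ is written $ab:x\to z$. The Cayley graph $\widetilde X$ is the directed graph with vertex set $G$ and one arrow $(g,x):g\to g(\varphi x)$ for each $(g,x)\in G\times X$. The free groupoid $F(\widetilde X)$ has object set $G$; its arrows are the pairs $(g,u)\in G\times F(X)$, with source $g$ and target $g(\varphi u)$, and composition $(g,u)(g(\varphi u),v)=(g,uv)$. *)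

theory Defs
  imports "HOL-Algebra.Coset"
begin

section \<open>Groups given by generators and relations; free groups\<close>

text \<open>A letter \<open>(a, True)\<close> stands for the generator \<open>a\<close>, and \<open>(a, False)\<close> for its inverse.\<close>

type_synonym 'a word = "('a \<times> bool) list"

definition words :: "'a set \<Rightarrow> 'a word set" where
  "words S = lists (S \<times> UNIV)"

inductive word_eq :: "'a set \<Rightarrow> ('a word \<times> 'a word) set \<Rightarrow> 'a word \<Rightarrow> 'a word \<Rightarrow> bool"
  for S :: "'a set" and Rel :: "('a word \<times> 'a word) set" where
  refl: "u \<in> words S \<Longrightarrow> word_eq S Rel u u"
| sym: "word_eq S Rel u v \<Longrightarrow> word_eq S Rel v u"
| trans: "word_eq S Rel u v \<Longrightarrow> word_eq S Rel v w \<Longrightarrow> word_eq S Rel u w"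
| cancel: "u \<in> words S \<Longrightarrow> v \<in> words S \<Longrightarrow> a \<in> S \<Longrightarrow>
    word_eq S Rel (u @ [(a, b), (a, \<not> b)] @ v) (u @ v)"
| relation: "u \<in> words S \<Longrightarrow> v \<in> words S \<Longrightarrow> (l, r) \<in> Rel \<Longrightarrow> l \<in> words S \<Longrightarrow> r \<in> words S \<Longrightarrow>
    word_eq S Rel (u @ l @ v) (u @ r @ v)"

definition word_class :: "'a set \<Rightarrow> ('a word \<times> 'a word) set \<Rightarrow> 'a word \<Rightarrow> 'a word set" where
  "word_class S Rel u = {v. word_eq S Rel u v}"

definition presented_group :: "'a set \<Rightarrow> ('a word \<times> 'a word) set \<Rightarrow> 'a word set monoid" where
  "presented_group S Rel =
    \<lparr>carrier = word_class S Rel ` words S,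
     mult = (\<lambda>A B. \<Union>u\<in>A. \<Union>v\<in>B. word_class S Rel (u @ v)),
     one = word_class S Rel []\<rparr>"

definition gen :: "'a set \<Rightarrow> ('a word \<times> 'a word) set \<Rightarrow> 'a \<Rightarrow> 'a word set" where
  "gen S Rel a = word_class S Rel [(a, True)]"

abbreviation free_group :: "'a set \<Rightarrow> 'a word set monoid" where
  "free_group X \<equiv> presented_group X {}"

abbreviation free_gen :: "'a set \<Rightarrow> 'a \<Rightarrow> 'a word set" where
  "free_gen X \<equiv> gen X {}"

lemma words_simps [simp]:
  "[] \<in> words S" "x # u \<in> words S \<longleftrightarrow> fst x \<in> S \<and> u \<in> words S"
  "u @ v \<in> words S \<longleftrightarrow> u \<in> words S \<and> v \<in> words S"
  by (auto simp: words_def mem_Times_iff)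

lemma word_eq_words: "word_eq S Rel u v \<Longrightarrow> u \<in> words S \<and> v \<in> words S"
  by (induction rule: word_eq.induct) auto

lemma word_eq_context:
  "word_eq S Rel u v \<Longrightarrow> p \<in> words S \<Longrightarrow> q \<in> words S \<Longrightarrow> word_eq S Rel (p @ u @ q) (p @ v @ q)"
proof (induction rule: word_eq.induct)
  case (cancel u v a b)
  then show ?case using word_eq.cancel[of "p @ u" S "v @ q" a Rel b] by simp
next
  case (relation u v l r)
  then show ?case using word_eq.relation[of "p @ u" S "v @ q" l r Rel] by simp
qed (auto intro: word_eq.intros)

lemma word_eq_append:
  assumes "word_eq S Rel u u'" "word_eq S Rel v v'"
  shows "word_eq S Rel (u @ v) (u' @ v')"
proof -
  have "word_eq S Rel (u @ v) (u' @ v)"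
    using word_eq_context[OF assms(1), of "[]" v] word_eq_words[OF assms(2)] by simp
  moreover have "word_eq S Rel (u' @ v) (u' @ v')"
    using word_eq_context[OF assms(2), of u' "[]"] word_eq_words[OF assms(1)] by simp
  ultimately show ?thesis by (rule word_eq.trans)
qed

lemma word_class_eq_iff:
  "u \<in> words S \<Longrightarrow> word_class S Rel u = word_class S Rel v \<longleftrightarrow> word_eq S Rel u v"
  unfolding word_class_def
  by (auto intro: word_eq.intros)

lemma word_class_mult:
  assumes "u \<in> words S" "v \<in> words S"
  shows "word_class S Rel u \<otimes>\<^bsub>presented_group S Rel\<^esub> word_class S Rel v = word_class S Rel (u @ v)"
proof -
  have "word_class S Rel (u' @ v') = word_class S Rel (u @ v)"
    if "u' \<in> word_class S Rel u" "v' \<in> word_class S Rel v" for u' v'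
    using that assms word_eq_append[of S Rel u u' v v']
    by (simp add: word_class_def) (metis assms words_simps(3) word_class_def word_class_eq_iff)
  then have "(\<Union>u'\<in>word_class S Rel u. \<Union>v'\<in>word_class S Rel v. word_class S Rel (u' @ v'))
      = (\<Union>u'\<in>word_class S Rel u. \<Union>v'\<in>word_class S Rel v. word_class S Rel (u @ v))"
    by (intro SUP_cong HOL.refl)
  moreover have "word_class S Rel u \<noteq> {}" "word_class S Rel v \<noteq> {}"
    using assms by (auto simp: word_class_def intro: word_eq.refl)
  ultimately show ?thesis by (simp add: presented_group_def)
qed

lemma presented_group_carrierE:
  assumes "A \<in> carrier (presented_group S Rel)"
  obtains u where "u \<in> words S" "A = word_class S Rel u"
  using assms by (auto simp: presented_group_def)

lemma word_class_closed [simp, intro]: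
  "u \<in> words S \<Longrightarrow> word_class S Rel u \<in> carrier (presented_group S Rel)"
  by (auto simp: presented_group_def)

lemma presented_group_one: "\<one>\<^bsub>presented_group S Rel\<^esub> = word_class S Rel []"
  by (simp add: presented_group_def)

lemma gen_closed [simp, intro]: "a \<in> S \<Longrightarrow> gen S Rel a \<in> carrier (presented_group S Rel)"
  by (simp add: gen_def)

definition word_inv :: "'a word \<Rightarrow> 'a word" where
  "word_inv w = rev (map (\<lambda>(a, b). (a, \<not> b)) w)"

lemma word_inv_words [simp]: "word_inv w \<in> words S \<longleftrightarrow> w \<in> words S"
  by (induction w) (auto simp: word_inv_def)

lemma word_eq_inv: "w \<in> words S \<Longrightarrow> word_eq S Rel (word_inv w @ w) []"
proof (induction w)
  case Nil
  then show ?case by (auto simp: word_inv_def intro: word_eq.refl)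
next
  case (Cons x w)
  obtain a b where x: "x = (a, b)" by (cases x)
  have eq: "word_inv (x # w) @ x # w = word_inv w @ [(a, \<not> b), (a, \<not> \<not> b)] @ w"
    by (simp add: word_inv_def x)
  have "word_eq S Rel (word_inv (x # w) @ x # w) (word_inv w @ w)"
    unfolding eq using Cons.prems x by (intro word_eq.cancel) auto
  with Cons show ?case by (auto intro: word_eq.trans)
qed

lemma presented_group_group: "group (presented_group S Rel)"
proof (rule groupI)
  fix A B assume "A \<in> carrier (presented_group S Rel)" "B \<in> carrier (presented_group S Rel)"
  then show "A \<otimes>\<^bsub>presented_group S Rel\<^esub> B \<in> carrier (presented_group S Rel)"
    by (auto elim!: presented_group_carrierE simp: word_class_mult)
next
  fix A assume "A \<in> carrier (presented_group S Rel)"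
  then obtain w where w: "w \<in> words S" "A = word_class S Rel w" by (rule presented_group_carrierE)
  then have "word_class S Rel (word_inv w) \<otimes>\<^bsub>presented_group S Rel\<^esub> A = \<one>\<^bsub>presented_group S Rel\<^esub>"
    by (simp add: word_class_mult presented_group_one word_class_eq_iff word_eq_inv)
  then show "\<exists>B\<in>carrier (presented_group S Rel). B \<otimes>\<^bsub>presented_group S Rel\<^esub> A = \<one>\<^bsub>presented_group S Rel\<^esub>"
    using w by (intro bexI[of _ "word_class S Rel (word_inv w)"]) auto
qed (auto elim!: presented_group_carrierE simp: word_class_mult presented_group_one)

lemma inv_gen:
  assumes "a \<in> S"
  shows "inv\<^bsub>presented_group S Rel\<^esub> (gen S Rel a) = word_class S Rel [(a, False)]"
proof -
  interpret group "presented_group S Rel" by (rule presented_group_group)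
  have "word_eq S Rel ([] @ [(a, False), (a, \<not> False)] @ []) ([] @ [])"
    using assms by (intro word_eq.cancel) auto
  then have "word_class S Rel [(a, False)] \<otimes>\<^bsub>presented_group S Rel\<^esub> gen S Rel a = \<one>\<^bsub>presented_group S Rel\<^esub>"
    using assms by (simp add: gen_def word_class_mult presented_group_one word_class_eq_iff)
  then show ?thesis using assms by (simp add: inv_equality)
qed

lemma presented_group_induct [consumes 1, case_names one gen inv mult]:
  assumes A: "A \<in> carrier (presented_group S Rel)"
    and one: "P \<one>\<^bsub>presented_group S Rel\<^esub>"
    and gen: "\<And>a. a \<in> S \<Longrightarrow> P (gen S Rel a)"
    and inv: "\<And>a. a \<in> S \<Longrightarrow> P (inv\<^bsub>presented_group S Rel\<^esub> (gen S Rel a))"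
    and mult: "\<And>A B. A \<in> carrier (presented_group S Rel) \<Longrightarrow> B \<in> carrier (presented_group S Rel) \<Longrightarrow>
      P A \<Longrightarrow> P B \<Longrightarrow> P (A \<otimes>\<^bsub>presented_group S Rel\<^esub> B)"
  shows "P A"
proof -
  have "P (word_class S Rel w)" if "w \<in> words S" for w
    using that
  proof (induction w)
    case Nil
    then show ?case using one by (simp add: presented_group_one)
  next
    case (Cons x w)
    obtain a b where x: "x = (a, b)" by (cases x)
    have aS: "a \<in> S" and w: "w \<in> words S" using Cons.prems x by auto
    have "P (word_class S Rel [x])"
      using gen[OF aS] inv[OF aS] aS x by (cases b) (simp_all add: inv_gen, simp add: gen_def)
    then have "P (word_class S Rel [x] \<otimes>\<^bsub>presented_group S Rel\<^esub> word_class S Rel w)"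
      using Cons.IH w aS x by (intro mult) auto
    then show ?case using aS w x by (simp add: word_class_mult)
  qed
  with A show ?thesis by (auto elim: presented_group_carrierE)
qed

lemma hom_eq_on_presented_group:
  assumes "group H" "h \<in> hom (presented_group S Rel) H" "h' \<in> hom (presented_group S Rel) H"
    and "\<And>a. a \<in> S \<Longrightarrow> h (gen S Rel a) = h' (gen S Rel a)"
    and "A \<in> carrier (presented_group S Rel)"
  shows "h A = h' A"
proof -
  interpret h: group_hom "presented_group S Rel" H h
    using assms presented_group_group by (auto intro!: group_hom.intro group_hom_axioms.intro)
  interpret h': group_hom "presented_group S Rel" H h'
    using assms presented_group_group by (auto intro!: group_hom.intro group_hom_axioms.intro)
  from assms(5) show ?thesis
    by (induction rule: presented_group_induct) (auto simp: assms(4))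
qed

definition eval_word :: "('h, 'e) monoid_scheme \<Rightarrow> ('a \<Rightarrow> 'h) \<Rightarrow> 'a word \<Rightarrow> 'h" where
  "eval_word H f w = foldr (\<lambda>(a, b) y. (if b then f a else inv\<^bsub>H\<^esub> (f a)) \<otimes>\<^bsub>H\<^esub> y) w \<one>\<^bsub>H\<^esub>"

definition lift_gen :: "('h, 'e) monoid_scheme \<Rightarrow> ('a \<Rightarrow> 'h) \<Rightarrow> 'a word set \<Rightarrow> 'h" where
  "lift_gen H f A = eval_word H f (SOME w. w \<in> A)"

lemma eval_word_simps [simp]:
  "eval_word H f [] = \<one>\<^bsub>H\<^esub>"
  "eval_word H f ((a, b) # w) = (if b then f a else inv\<^bsub>H\<^esub> (f a)) \<otimes>\<^bsub>H\<^esub> eval_word H f w"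
  by (simp_all add: eval_word_def)

context group
begin

lemma eval_word_closed:
  "f \<in> S \<rightarrow> carrier G \<Longrightarrow> w \<in> words S \<Longrightarrow> eval_word G f w \<in> carrier G"
  by (induction w) (auto simp: Pi_iff)

lemma eval_word_append:
  "f \<in> S \<rightarrow> carrier G \<Longrightarrow> u \<in> words S \<Longrightarrow> v \<in> words S \<Longrightarrow>
    eval_word G f (u @ v) = eval_word G f u \<otimes> eval_word G f v"
proof (induction u)
  case (Cons x u)
  obtain a b where x: "x = (a, b)" by (cases x)
  have "f a \<in> carrier G" using Cons.prems x by auto
  with Cons x eval_word_closed[OF Cons.prems(1)] show ?case by (simp add: m_assoc)
qed (simp add: eval_word_closed)

lemma eval_word_eq:
  assumes f: "f \<in> S \<rightarrow> carrier G"
    and rel: "\<And>l r. (l, r) \<in> Rel \<Longrightarrow> l \<in> words S \<Longrightarrow> r \<in> words S \<Longrightarrow> eval_word G f l = eval_word G f r"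
    and "word_eq S Rel u v"
  shows "eval_word G f u = eval_word G f v"
  using assms(3)
proof (induction rule: word_eq.induct)
  case (cancel u v a b)
  have fa: "f a \<in> carrier G" using f cancel by auto
  note c = eval_word_closed[OF f]
  have "eval_word G f ([(a, b), (a, \<not> b)] @ v) = eval_word G f v"
    using fa c cancel by (cases b) (simp_all add: m_assoc[symmetric])
  then show ?case using cancel by (simp only: eval_word_append[OF f] words_simps fst_conv simp_thms)
next
  case (relation u v l r)
  then show ?case by (simp add: eval_word_append[OF f] rel)
qed auto

lemma lift_gen_word_class:
  assumes "f \<in> S \<rightarrow> carrier G"
    and "\<And>l r. (l, r) \<in> Rel \<Longrightarrow> l \<in> words S \<Longrightarrow> r \<in> words S \<Longrightarrow> eval_word G f l = eval_word G f r"
    and "w \<in> words S"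
  shows "lift_gen G f (word_class S Rel w) = eval_word G f w"
proof -
  have "(SOME v. v \<in> word_class S Rel w) \<in> word_class S Rel w"
    using assms(3) by (intro someI_ex[of "\<lambda>v. v \<in> word_class S Rel w"]) (auto simp: word_class_def intro: word_eq.refl)
  then have "word_eq S Rel w (SOME v. v \<in> word_class S Rel w)" by (simp add: word_class_def)
  then show ?thesis using eval_word_eq[OF assms(1,2)] by (simp add: lift_gen_def)
qed

text \<open>Universal property of \<^const>\<open>presented_group\<close>; uniqueness of the extension is
  \<open>hom_eq_on_presented_group\<close>.\<close>

lemma lift_gen_hom:
  assumes "f \<in> S \<rightarrow> carrier G"
    and "\<And>l r. (l, r) \<in> Rel \<Longrightarrow> l \<in> words S \<Longrightarrow> r \<in> words S \<Longrightarrow> eval_word G f l = eval_word G f r"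
  shows "lift_gen G f \<in> hom (presented_group S Rel) G"
    and "a \<in> S \<Longrightarrow> lift_gen G f (gen S Rel a) = f a"
proof -
  show "lift_gen G f \<in> hom (presented_group S Rel) G"
    by (rule homI)
       (auto elim!: presented_group_carrierE simp: word_class_mult lift_gen_word_class[OF assms]
          eval_word_append[OF assms(1)] eval_word_closed[OF assms(1)])
  show "lift_gen G f (gen S Rel a) = f a" if "a \<in> S"
    using that assms(1) by (auto simp: gen_def lift_gen_word_class[OF assms] Pi_iff)
qed

end

section \<open>Presentations of groups\<close>

definition normal_closure :: "('a, 'e) monoid_scheme \<Rightarrow> 'a set \<Rightarrow> 'a set" where
  "normal_closure G S = \<Inter>{N. N \<lhd> G \<and> S \<subseteq> N}"

locale group_presentation = group G
  for G :: "('g, 'e) monoid_scheme" (structure) +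
  fixes X :: "'x set" and R :: "'r set" and \<omega> :: "'r \<Rightarrow> 'x word set" and \<phi> :: "'x word set \<Rightarrow> 'g"
  assumes omega: "\<omega> \<in> R \<rightarrow> carrier (free_group X)"
    and phi: "\<phi> \<in> epi (free_group X) G"
    and kernel_phi: "kernel (free_group X) G \<phi> = normal_closure (free_group X) (\<omega> ` R)"

section \<open>Crossed modules\<close>

text \<open>\<open>act m u\<close> is \<open>m\<close> acted on by \<open>u\<close> from the right, i.e. \<open>m\<^sup>u\<close>.  That each \<open>u\<close> acts by an
  automorphism follows from \<open>act_mult\<close>, \<open>act_one\<close> and \<open>act_comp\<close>.\<close>

locale crossed_module = F: group F + M: group M
  for F :: "('f, 'e) monoid_scheme" and M :: "('m, 'd) monoid_scheme" +
  fixes \<mu> :: "'m \<Rightarrow> 'f" and act :: "'m \<Rightarrow> 'f \<Rightarrow> 'm"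
  assumes mu_hom: "\<mu> \<in> hom M F"
    and act_closed: "m \<in> carrier M \<Longrightarrow> u \<in> carrier F \<Longrightarrow> act m u \<in> carrier M"
    and act_mult: "m \<in> carrier M \<Longrightarrow> n \<in> carrier M \<Longrightarrow> u \<in> carrier F \<Longrightarrow>
      act (m \<otimes>\<^bsub>M\<^esub> n) u = act m u \<otimes>\<^bsub>M\<^esub> act n u"
    and act_one: "m \<in> carrier M \<Longrightarrow> act m \<one>\<^bsub>F\<^esub> = m"
    and act_comp: "m \<in> carrier M \<Longrightarrow> u \<in> carrier F \<Longrightarrow> v \<in> carrier F \<Longrightarrow>
      act (act m u) v = act m (u \<otimes>\<^bsub>F\<^esub> v)"
    and equivariant: "m \<in> carrier M \<Longrightarrow> u \<in> carrier F \<Longrightarrow>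
      \<mu> (act m u) = inv\<^bsub>F\<^esub> u \<otimes>\<^bsub>F\<^esub> \<mu> m \<otimes>\<^bsub>F\<^esub> u"
    and peiffer: "m \<in> carrier M \<Longrightarrow> n \<in> carrier M \<Longrightarrow>
      inv\<^bsub>M\<^esub> n \<otimes>\<^bsub>M\<^esub> m \<otimes>\<^bsub>M\<^esub> n = act m (\<mu> n)"

definition crossed_module_hom ::
  "('f, 'e) monoid_scheme \<Rightarrow> ('m, 'd) monoid_scheme \<Rightarrow> ('m \<Rightarrow> 'f) \<Rightarrow> ('m \<Rightarrow> 'f \<Rightarrow> 'm) \<Rightarrow>
    ('n, 'c) monoid_scheme \<Rightarrow> ('n \<Rightarrow> 'f) \<Rightarrow> ('n \<Rightarrow> 'f \<Rightarrow> 'n) \<Rightarrow> ('m \<Rightarrow> 'n) \<Rightarrow> bool" where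
  "crossed_module_hom F M \<mu> act N \<nu> act' h \<longleftrightarrow>
    h \<in> hom M N \<and> (\<forall>m\<in>carrier M. \<nu> (h m) = \<mu> m) \<and>
    (\<forall>m\<in>carrier M. \<forall>u\<in>carrier F. h (act m u) = act' (h m) u)"

text \<open>Initiality among the crossed \<open>F\<close>-modules \<open>\<mu> : M \<rightarrow> F\<close> that come with \<open>f : R \<rightarrow> M\<close>,
  \<open>\<mu> \<circ> f = \<omega>\<close>, and whose elements belong to the type \<open>'m\<close>.\<close>

definition initial_crossed_module ::
  "'m itself \<Rightarrow> ('f, 'e) monoid_scheme \<Rightarrow> 'r set \<Rightarrow> ('r \<Rightarrow> 'f) \<Rightarrow>
    'c monoid \<Rightarrow> ('c \<Rightarrow> 'f) \<Rightarrow> ('c \<Rightarrow> 'f \<Rightarrow> 'c) \<Rightarrow> ('r \<Rightarrow> 'c) \<Rightarrow> bool" where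
  "initial_crossed_module TYPE('m) F R \<omega> C \<delta> act \<iota> \<longleftrightarrow>
    (\<forall>(M :: 'm monoid) \<mu> act' f.
      crossed_module F M \<mu> act' \<and> f \<in> R \<rightarrow> carrier M \<and> (\<forall>r\<in>R. \<mu> (f r) = \<omega> r) \<longrightarrow>
      (\<exists>!h. h \<in> extensional (carrier C) \<and> crossed_module_hom F C \<delta> act M \<mu> act' h \<and>
        (\<forall>r\<in>R. h (\<iota> r) = f r)))"

text \<open>The universal property of the free crossed module on \<open>\<omega> : R \<rightarrow> F\<close> refers to crossed modules
  over arbitrary types, which a single formula cannot quantify over.  It suffices to demand it for
  two types: the type of \<open>C\<close> and the type of the standard construction by generators and
  relations.  The lemma \<open>free_crossed_module_universal\<close> below then provides it for all types, and
  \<open>free_crossed_module_standard\<close> shows that the standard construction is a free crossed module.\<close>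

definition free_crossed_module ::
  "('f, 'e) monoid_scheme \<Rightarrow> 'r set \<Rightarrow> ('r \<Rightarrow> 'f) \<Rightarrow>
    'c monoid \<Rightarrow> ('c \<Rightarrow> 'f) \<Rightarrow> ('c \<Rightarrow> 'f \<Rightarrow> 'c) \<Rightarrow> ('r \<Rightarrow> 'c) \<Rightarrow> bool" where
  "free_crossed_module F R \<omega> C \<delta> act \<iota> \<longleftrightarrow>
    crossed_module F C \<delta> act \<and> \<iota> \<in> R \<rightarrow> carrier C \<and> (\<forall>r\<in>R. \<delta> (\<iota> r) = \<omega> r) \<and>
    initial_crossed_module TYPE('c) F R \<omega> C \<delta> act \<iota> \<and>
    initial_crossed_module TYPE(('r \<times> 'f) word set) F R \<omega> C \<delta> act \<iota>"


locale standard_crossed_module = F: group F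
  for F :: "('f, 'e) monoid_scheme" (structure) +
  fixes R :: "'r set" and \<omega> :: "'r \<Rightarrow> 'f"
  assumes omega: "\<omega> \<in> R \<rightarrow> carrier F"
begin

text \<open>The letter \<open>(r, u)\<close> stands for \<open>r\<^sup>u\<close>.\<close>

definition peiffer_relations :: "(('r \<times> 'f) word \<times> ('r \<times> 'f) word) set" where
  "peiffer_relations =
    {([((r, u), False), ((s, v), True), ((r, u), True)], [((s, v \<otimes> (inv u \<otimes> \<omega> r \<otimes> u)), True)]) |
      r s u v. r \<in> R \<and> s \<in> R \<and> u \<in> carrier F \<and> v \<in> carrier F}"

definition std_carrier :: "('r \<times> 'f) word set monoid" where
  "std_carrier = presented_group (R \<times> carrier F) peiffer_relations"

definition std_gen :: "'r \<Rightarrow> 'f \<Rightarrow> ('r \<times> 'f) word set" where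
  "std_gen r u = gen (R \<times> carrier F) peiffer_relations (r, u)"

definition std_boundary :: "('r \<times> 'f) word set \<Rightarrow> 'f" where
  "std_boundary = lift_gen F (\<lambda>(r, u). inv u \<otimes> \<omega> r \<otimes> u)"

definition std_act :: "('r \<times> 'f) word set \<Rightarrow> 'f \<Rightarrow> ('r \<times> 'f) word set" where
  "std_act m a = lift_gen std_carrier (\<lambda>(r, u). std_gen r (u \<otimes> a)) m"

definition std_incl :: "'r \<Rightarrow> ('r \<times> 'f) word set" where
  "std_incl r = std_gen r \<one>"

lemma omega_closed [simp]: "r \<in> R \<Longrightarrow> \<omega> r \<in> carrier F"
  using omega by auto

sublocale K: group std_carrier
  unfolding std_carrier_def by (rule presented_group_group)

lemma std_gen_closed [simp]: "r \<in> R \<Longrightarrow> u \<in> carrier F \<Longrightarrow> std_gen r u \<in> carrier std_carrier"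
  by (simp add: std_gen_def std_carrier_def gen_closed)

lemma std_peiffer_gen:
  assumes "r \<in> R" "s \<in> R" "u \<in> carrier F" "v \<in> carrier F"
  shows "inv\<^bsub>std_carrier\<^esub> std_gen r u \<otimes>\<^bsub>std_carrier\<^esub> std_gen s v \<otimes>\<^bsub>std_carrier\<^esub> std_gen r u
    = std_gen s (v \<otimes> (inv u \<otimes> \<omega> r \<otimes> u))"
proof -
  let ?S = "R \<times> carrier F"
  have "word_eq ?S peiffer_relations
      ([] @ [((r, u), False), ((s, v), True), ((r, u), True)] @ [])
      ([] @ [((s, v \<otimes> (inv u \<otimes> \<omega> r \<otimes> u)), True)] @ [])"
    using assms by (intro word_eq.relation) (auto simp: peiffer_relations_def)
  moreover have "inv\<^bsub>std_carrier\<^esub> std_gen r u = word_class ?S peiffer_relations [((r, u), False)]"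
    using assms unfolding std_carrier_def std_gen_def by (intro inv_gen) auto
  ultimately show ?thesis
    using assms by (simp add: std_gen_def std_carrier_def gen_def word_class_mult word_class_eq_iff)
qed

lemma std_lift:
  assumes "group H" and f: "\<And>r u. r \<in> R \<Longrightarrow> u \<in> carrier F \<Longrightarrow> f r u \<in> carrier H"
    and rel: "\<And>r s u v. r \<in> R \<Longrightarrow> s \<in> R \<Longrightarrow> u \<in> carrier F \<Longrightarrow> v \<in> carrier F \<Longrightarrow>
      inv\<^bsub>H\<^esub> f r u \<otimes>\<^bsub>H\<^esub> f s v \<otimes>\<^bsub>H\<^esub> f r u = f s (v \<otimes> (inv u \<otimes> \<omega> r \<otimes> u))"
  shows "lift_gen H (\<lambda>(r, u). f r u) \<in> hom std_carrier H"
    and "r \<in> R \<Longrightarrow> u \<in> carrier F \<Longrightarrow> lift_gen H (\<lambda>(r, u). f r u) (std_gen r u) = f r u"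
proof -
  interpret H: group H by fact
  have 1: "(\<lambda>(r, u). f r u) \<in> R \<times> carrier F \<rightarrow> carrier H" using f by auto
  have 2: "eval_word H (\<lambda>(r, u). f r u) l = eval_word H (\<lambda>(r, u). f r u) l'"
    if "(l, l') \<in> peiffer_relations" for l l'
    using that rel f by (auto simp: peiffer_relations_def H.m_assoc[symmetric])
  show "lift_gen H (\<lambda>(r, u). f r u) \<in> hom std_carrier H"
    unfolding std_carrier_def using 1 2 by (rule H.lift_gen_hom(1))
  show "lift_gen H (\<lambda>(r, u). f r u) (std_gen r u) = f r u" if "r \<in> R" "u \<in> carrier F"
    using H.lift_gen_hom(2)[OF 1 2, of peiffer_relations "(r, u)"] that
    by (simp add: std_gen_def)
qed

lemma std_hom_eq:
  assumes "group H" "h \<in> hom std_carrier H" "h' \<in> hom std_carrier H"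
    and "\<And>r u. r \<in> R \<Longrightarrow> u \<in> carrier F \<Longrightarrow> h (std_gen r u) = h' (std_gen r u)"
    and "m \<in> carrier std_carrier"
  shows "h m = h' m"
  using assms hom_eq_on_presented_group[of H h "R \<times> carrier F" peiffer_relations h' m]
  by (auto simp: std_carrier_def std_gen_def)

lemma std_boundary_hom: "std_boundary \<in> hom std_carrier F"
  and std_boundary_gen: "r \<in> R \<Longrightarrow> u \<in> carrier F \<Longrightarrow> std_boundary (std_gen r u) = inv u \<otimes> \<omega> r \<otimes> u"
proof -
  have rel: "inv (inv u \<otimes> \<omega> r \<otimes> u) \<otimes> (inv v \<otimes> \<omega> s \<otimes> v) \<otimes> (inv u \<otimes> \<omega> r \<otimes> u)
      = inv (v \<otimes> (inv u \<otimes> \<omega> r \<otimes> u)) \<otimes> \<omega> s \<otimes> (v \<otimes> (inv u \<otimes> \<omega> r \<otimes> u))"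
    if "r \<in> R" "s \<in> R" "u \<in> carrier F" "v \<in> carrier F" for r s u v
    using that by (simp add: F.inv_mult_group F.m_assoc)
  show "std_boundary \<in> hom std_carrier F"
    unfolding std_boundary_def by (rule std_lift(1)) (simp_all add: rel)
  show "std_boundary (std_gen r u) = inv u \<otimes> \<omega> r \<otimes> u" if "r \<in> R" "u \<in> carrier F"
    unfolding std_boundary_def by (rule std_lift(2)) (simp_all add: rel that)
qed

lemma std_act_hom: "a \<in> carrier F \<Longrightarrow> (\<lambda>m. std_act m a) \<in> hom std_carrier std_carrier"
  and std_act_gen: "a \<in> carrier F \<Longrightarrow> r \<in> R \<Longrightarrow> u \<in> carrier F \<Longrightarrow>
    std_act (std_gen r u) a = std_gen r (u \<otimes> a)"
proof -
  have rel: "inv\<^bsub>std_carrier\<^esub> std_gen r (u \<otimes> a) \<otimes>\<^bsub>std_carrier\<^esub> std_gen s (v \<otimes> a)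
      \<otimes>\<^bsub>std_carrier\<^esub> std_gen r (u \<otimes> a) = std_gen s (v \<otimes> (inv u \<otimes> \<omega> r \<otimes> u) \<otimes> a)"
    if "r \<in> R" "s \<in> R" "u \<in> carrier F" "v \<in> carrier F" "a \<in> carrier F" for r s u v a
  proof -
    have "v \<otimes> a \<otimes> (inv (u \<otimes> a) \<otimes> \<omega> r \<otimes> (u \<otimes> a)) = v \<otimes> (inv u \<otimes> \<omega> r \<otimes> u) \<otimes> a"
    proof -
      have "x \<otimes> (inv x \<otimes> y) = y" if "x \<in> carrier F" "y \<in> carrier F" for x y
        using that by (simp add: F.m_assoc[symmetric])
      then show ?thesis using that by (simp add: F.inv_mult_group F.m_assoc)
    qed
    then show ?thesis using that by (simp add: std_peiffer_gen)
  qed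
  show "(\<lambda>m. std_act m a) \<in> hom std_carrier std_carrier" if "a \<in> carrier F"
    unfolding std_act_def by (rule std_lift(1)) (simp_all add: rel that K.group_axioms)
  show "std_act (std_gen r u) a = std_gen r (u \<otimes> a)"
    if "a \<in> carrier F" "r \<in> R" "u \<in> carrier F"
    unfolding std_act_def by (rule std_lift(2)) (simp_all add: rel that K.group_axioms)
qed

lemma std_act_closed:
  "a \<in> carrier F \<Longrightarrow> m \<in> carrier std_carrier \<Longrightarrow> std_act m a \<in> carrier std_carrier"
  using std_act_hom hom_in_carrier by fastforce

lemma std_boundary_closed [simp]: "m \<in> carrier std_carrier \<Longrightarrow> std_boundary m \<in> carrier F"
  using std_boundary_hom hom_in_carrier by fastforce

lemma std_act_comp:
  assumes "m \<in> carrier std_carrier" "a \<in> carrier F" "b \<in> carrier F"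
  shows "std_act (std_act m a) b = std_act m (a \<otimes> b)"
proof (rule std_hom_eq[OF K.group_axioms _ _ _ assms(1)])
  show "(\<lambda>m. std_act (std_act m a) b) \<in> hom std_carrier std_carrier"
    using hom_compose[OF std_act_hom[OF assms(2)] std_act_hom[OF assms(3)]] by (simp add: comp_def)
qed (simp_all add: assms std_act_hom std_act_gen F.m_assoc)

lemma std_act_one: "m \<in> carrier std_carrier \<Longrightarrow> std_act m \<one> = m"
  by (rule std_hom_eq[OF K.group_axioms std_act_hom[of \<one>], where h' = "\<lambda>m. m"])
     (simp_all add: std_act_gen hom_def)

lemma std_conj_hom:
  "group H \<Longrightarrow> n \<in> carrier H \<Longrightarrow> (\<lambda>m. inv\<^bsub>H\<^esub> n \<otimes>\<^bsub>H\<^esub> m \<otimes>\<^bsub>H\<^esub> n) \<in> hom H H"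
proof -
  assume "group H" and n: "n \<in> carrier H"
  interpret H: group H by fact
  have "n \<otimes>\<^bsub>H\<^esub> (inv\<^bsub>H\<^esub> n \<otimes>\<^bsub>H\<^esub> y) = y" if "y \<in> carrier H" for y
    using n that by (simp add: H.m_assoc[symmetric])
  then show ?thesis using n by (intro homI) (simp_all add: H.m_assoc)
qed

lemma std_equivariant:
  assumes "m \<in> carrier std_carrier" "a \<in> carrier F"
  shows "std_boundary (std_act m a) = inv a \<otimes> std_boundary m \<otimes> a"
proof (rule std_hom_eq[OF F.group_axioms _ _ _ assms(1)])
  show "(\<lambda>m. std_boundary (std_act m a)) \<in> hom std_carrier F"
    using hom_compose[OF std_act_hom[OF assms(2)] std_boundary_hom] by (simp add: comp_def)
  show "(\<lambda>m. inv a \<otimes> std_boundary m \<otimes> a) \<in> hom std_carrier F"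
    using hom_compose[OF std_boundary_hom std_conj_hom[OF F.group_axioms assms(2)]]
    by (simp add: comp_def)
qed (simp add: assms std_act_gen std_boundary_gen F.inv_mult_group F.m_assoc)

lemma std_peiffer:
  assumes m: "m \<in> carrier std_carrier" and n: "n \<in> carrier std_carrier"
  shows "inv\<^bsub>std_carrier\<^esub> n \<otimes>\<^bsub>std_carrier\<^esub> m \<otimes>\<^bsub>std_carrier\<^esub> n = std_act m (std_boundary n)"
proof -
  interpret d: group_hom std_carrier F std_boundary
    by (intro group_hom.intro group_hom_axioms.intro K.group_axioms F.group_axioms std_boundary_hom)
  let ?P = "\<lambda>n. n \<in> carrier std_carrier \<and> (\<forall>m\<in>carrier std_carrier.
    inv\<^bsub>std_carrier\<^esub> n \<otimes>\<^bsub>std_carrier\<^esub> m \<otimes>\<^bsub>std_carrier\<^esub> n = std_act m (std_boundary n))"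
  have gen: "?P (std_gen r u)" if "r \<in> R" "u \<in> carrier F" for r u
  proof (intro conjI ballI)
    fix m assume m: "m \<in> carrier std_carrier"
    show "inv\<^bsub>std_carrier\<^esub> std_gen r u \<otimes>\<^bsub>std_carrier\<^esub> m \<otimes>\<^bsub>std_carrier\<^esub> std_gen r u
        = std_act m (std_boundary (std_gen r u))"
      by (rule std_hom_eq[OF K.group_axioms std_conj_hom[OF K.group_axioms] std_act_hom _ m])
         (simp_all add: that std_peiffer_gen std_act_gen std_boundary_gen)
  qed (simp add: that)
  have inv: "?P (inv\<^bsub>std_carrier\<^esub> n)" if P: "?P n" for n
  proof (intro conjI ballI)
    fix m assume m: "m \<in> carrier std_carrier"
    let ?m' = "n \<otimes>\<^bsub>std_carrier\<^esub> m \<otimes>\<^bsub>std_carrier\<^esub> inv\<^bsub>std_carrier\<^esub> n"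
    have m': "?m' \<in> carrier std_carrier" using P m by simp
    have "inv\<^bsub>std_carrier\<^esub> n \<otimes>\<^bsub>std_carrier\<^esub> ?m' \<otimes>\<^bsub>std_carrier\<^esub> n = m"
      using P m by (simp add: K.m_assoc) (simp add: K.m_assoc[symmetric])
    then have "m = std_act ?m' (std_boundary n)" using P m' by simp
    moreover have "std_act (std_act ?m' (std_boundary n)) (inv (std_boundary n)) = ?m'"
      using P m' by (simp add: std_act_comp std_act_one)
    ultimately have "std_act m (inv (std_boundary n)) = ?m'" by simp
    then show "inv\<^bsub>std_carrier\<^esub> (inv\<^bsub>std_carrier\<^esub> n) \<otimes>\<^bsub>std_carrier\<^esub> m \<otimes>\<^bsub>std_carrier\<^esub> inv\<^bsub>std_carrier\<^esub> n
        = std_act m (std_boundary (inv\<^bsub>std_carrier\<^esub> n))"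
      using P by simp
  qed (use P in simp)
  have mult: "?P (A \<otimes>\<^bsub>std_carrier\<^esub> B)" if A: "?P A" and B: "?P B" for A B
  proof (intro conjI ballI)
    fix m assume m: "m \<in> carrier std_carrier"
    have "inv\<^bsub>std_carrier\<^esub> (A \<otimes>\<^bsub>std_carrier\<^esub> B) \<otimes>\<^bsub>std_carrier\<^esub> m \<otimes>\<^bsub>std_carrier\<^esub> (A \<otimes>\<^bsub>std_carrier\<^esub> B)
        = inv\<^bsub>std_carrier\<^esub> B \<otimes>\<^bsub>std_carrier\<^esub>
          (inv\<^bsub>std_carrier\<^esub> A \<otimes>\<^bsub>std_carrier\<^esub> m \<otimes>\<^bsub>std_carrier\<^esub> A) \<otimes>\<^bsub>std_carrier\<^esub> B"
      using A B m by (simp add: K.m_assoc K.inv_mult_group)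
    also have "\<dots> = std_act (std_act m (std_boundary A)) (std_boundary B)"
      using A B m by (simp add: std_act_closed)
    also have "\<dots> = std_act m (std_boundary (A \<otimes>\<^bsub>std_carrier\<^esub> B))"
      using A B m by (simp add: std_act_comp)
    finally show "inv\<^bsub>std_carrier\<^esub> (A \<otimes>\<^bsub>std_carrier\<^esub> B) \<otimes>\<^bsub>std_carrier\<^esub> m \<otimes>\<^bsub>std_carrier\<^esub> (A \<otimes>\<^bsub>std_carrier\<^esub> B)
        = std_act m (std_boundary (A \<otimes>\<^bsub>std_carrier\<^esub> B))" .
  qed (use A B in simp)
  have one: "?P \<one>\<^bsub>std_carrier\<^esub>" by (simp add: std_act_one)
  have "?P n"
    using n unfolding std_carrier_def
  proof (induction rule: presented_group_induct)
    case one
    then show ?case using \<open>?P \<one>\<^bsub>std_carrier\<^esub>\<close> unfolding std_carrier_def .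
  next
    case (gen x)
    then show ?case using \<open>\<And>r u. r \<in> R \<Longrightarrow> u \<in> carrier F \<Longrightarrow> ?P (std_gen r u)\<close>[of "fst x" "snd x"]
      unfolding std_carrier_def std_gen_def by auto
  next
    case (inv x)
    then show ?case using \<open>\<And>n. ?P n \<Longrightarrow> ?P (inv\<^bsub>std_carrier\<^esub> n)\<close>[OF gen[of "fst x" "snd x"]]
      unfolding std_carrier_def std_gen_def by auto
  next
    case (mult A B)
    show ?case using \<open>\<And>A B. ?P A \<Longrightarrow> ?P B \<Longrightarrow> ?P (A \<otimes>\<^bsub>std_carrier\<^esub> B)\<close>[of A B] mult.IH
      unfolding std_carrier_def by blast
  qed
  then show ?thesis using m by blast
qed

lemma std_crossed_module: "crossed_module F std_carrier std_boundary std_act"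
proof (unfold_locales, goal_cases)
  case (3 m n u)
  then show ?case using std_act_hom[of u] hom_mult by fastforce
qed (simp_all add: std_boundary_hom std_act_closed std_act_one std_act_comp std_equivariant std_peiffer)

lemma std_initial:
  "initial_crossed_module TYPE('m) F R \<omega> std_carrier std_boundary std_act std_incl"
  unfolding initial_crossed_module_def
proof (intro allI impI)
  fix M :: "'m monoid" and \<mu> act' f
  assume a: "crossed_module F M \<mu> act' \<and> f \<in> R \<rightarrow> carrier M \<and> (\<forall>r\<in>R. \<mu> (f r) = \<omega> r)"
  then interpret M: crossed_module F M \<mu> act' by blast
  have f: "f r \<in> carrier M" and mu_f: "\<mu> (f r) = \<omega> r" if "r \<in> R" for r using a that by auto
  define h where "h = lift_gen M (\<lambda>(r, u). act' (f r) u)"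
  have rel: "inv\<^bsub>M\<^esub> act' (f r) u \<otimes>\<^bsub>M\<^esub> act' (f s) v \<otimes>\<^bsub>M\<^esub> act' (f r) u
      = act' (f s) (v \<otimes> (inv u \<otimes> \<omega> r \<otimes> u))"
    if "r \<in> R" "s \<in> R" "u \<in> carrier F" "v \<in> carrier F" for r s u v
    using that by (simp add: M.peiffer M.act_closed f M.equivariant mu_f M.act_comp)
  have h_hom: "h \<in> hom std_carrier M"
    unfolding h_def by (rule std_lift(1)) (simp_all add: rel f M.act_closed M.M.group_axioms)
  have h_gen: "h (std_gen r u) = act' (f r) u" if "r \<in> R" "u \<in> carrier F" for r u
    unfolding h_def by (rule std_lift(2)) (simp_all add: that rel f M.act_closed M.M.group_axioms)
  have act_hom: "(\<lambda>m. act' m u) \<in> hom M M" if "u \<in> carrier F" for u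
    using that by (intro homI) (simp_all add: M.act_closed M.act_mult)
  have h_closed: "h m \<in> carrier M" if "m \<in> carrier std_carrier" for m
    using hom_in_carrier[OF h_hom that] .
  have h_mu: "\<mu> (h m) = std_boundary m" if m: "m \<in> carrier std_carrier" for m
    by (rule std_hom_eq[OF F.group_axioms _ std_boundary_hom _ m])
       (use hom_compose[OF h_hom M.mu_hom] in
         \<open>simp_all add: comp_def h_gen M.equivariant f mu_f std_boundary_gen\<close>)
  have h_act: "h (std_act m u) = act' (h m) u" if m: "m \<in> carrier std_carrier" and u: "u \<in> carrier F" for m u
    by (rule std_hom_eq[OF M.M.group_axioms _ _ _ m])
       (use hom_compose[OF std_act_hom[OF u] h_hom] hom_compose[OF h_hom act_hom[OF u]] u in
         \<open>simp_all add: comp_def h_gen std_act_gen M.act_comp f\<close>)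
  let ?Q = "\<lambda>h. h \<in> extensional (carrier std_carrier) \<and>
    crossed_module_hom F std_carrier std_boundary std_act M \<mu> act' h \<and> (\<forall>r\<in>R. h (std_incl r) = f r)"
  show "\<exists>!h. ?Q h"
  proof (rule ex1I)
    have r: "restrict h (carrier std_carrier) \<in> hom std_carrier M"
      using h_hom by (auto simp: hom_def)
    then show "?Q (restrict h (carrier std_carrier))"
      by (simp add: crossed_module_hom_def h_mu h_act std_act_closed std_incl_def h_gen f M.act_one)
    fix h' assume h': "?Q h'"
    show "h' = restrict h (carrier std_carrier)"
    proof (rule extensionalityI)
      fix m assume m: "m \<in> carrier std_carrier"
      show "h' m = restrict h (carrier std_carrier) m"
      proof (rule std_hom_eq[OF M.M.group_axioms _ r _ m])
        fix s u assume su: "s \<in> R" "u \<in> carrier F"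
        have "h' (std_gen s u) = h' (std_act (std_incl s) u)"
          using su by (simp add: std_incl_def std_act_gen)
        also have "\<dots> = act' (f s) u"
          using su h' by (simp add: crossed_module_hom_def std_incl_def)
        finally show "h' (std_gen s u) = restrict h (carrier std_carrier) (std_gen s u)"
          using su by (simp add: h_gen)
      qed (use h' in \<open>simp add: crossed_module_hom_def\<close>)
    qed (use h' in auto)
  qed
qed

theorem free_crossed_module_standard:
  "free_crossed_module F R \<omega> std_carrier std_boundary std_act std_incl"
  unfolding free_crossed_module_def
  by (auto simp: std_crossed_module std_initial) (simp_all add: std_incl_def std_boundary_gen)

end

lemma crossed_module_hom_comp:
  assumes "crossed_module_hom F A \<alpha> act1 B \<beta> act2 g" "crossed_module_hom F B \<beta> act2 C \<gamma> act3 h"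
  shows "crossed_module_hom F A \<alpha> act1 C \<gamma> act3 (h \<circ> g)"
  using assms hom_compose[of g A B h C] hom_in_carrier[of g A B]
  by (simp add: crossed_module_hom_def)

lemma initial_crossed_module_ex1:
  fixes C :: "'c monoid" and M :: "'m monoid"
  assumes "initial_crossed_module TYPE('m) F R \<omega> C \<delta> act \<iota>"
    and "crossed_module F M \<mu> act'" and "f \<in> R \<rightarrow> carrier M" and "\<And>r. r \<in> R \<Longrightarrow> \<mu> (f r) = \<omega> r"
  shows "\<exists>!h. h \<in> extensional (carrier C) \<and> crossed_module_hom F C \<delta> act M \<mu> act' h \<and>
    (\<forall>r\<in>R. h (\<iota> r) = f r)"
proof -
  have "crossed_module F M \<mu> act' \<and> f \<in> R \<rightarrow> carrier M \<and> (\<forall>r\<in>R. \<mu> (f r) = \<omega> r)"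
    using assms(2-) by simp
  then show ?thesis
    by (rule assms(1)[unfolded initial_crossed_module_def, THEN spec, THEN spec, THEN spec, THEN spec, THEN mp])
qed

lemma initial_crossed_module_exists:
  fixes C :: "'c monoid" and M :: "'m monoid"
  assumes "initial_crossed_module TYPE('m) F R \<omega> C \<delta> act \<iota>"
    and "crossed_module F M \<mu> act'" and "f \<in> R \<rightarrow> carrier M" and "\<And>r. r \<in> R \<Longrightarrow> \<mu> (f r) = \<omega> r"
  obtains h where "crossed_module_hom F C \<delta> act M \<mu> act' h" "\<And>r. r \<in> R \<Longrightarrow> h (\<iota> r) = f r"
  using ex1_implies_ex[OF initial_crossed_module_ex1[OF assms]] by blast

lemma initial_crossed_module_unique:
  fixes C :: "'c monoid" and M :: "'m monoid"
  assumes init: "initial_crossed_module TYPE('m) F R \<omega> C \<delta> act \<iota>" and cm: "crossed_module F C \<delta> act"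
    and M: "crossed_module F M \<mu> act'" and "\<iota> \<in> R \<rightarrow> carrier C" and "\<And>r. r \<in> R \<Longrightarrow> \<delta> (\<iota> r) = \<omega> r"
    and h: "crossed_module_hom F C \<delta> act M \<mu> act' h" "crossed_module_hom F C \<delta> act M \<mu> act' h'"
    and eq: "\<And>r. r \<in> R \<Longrightarrow> h (\<iota> r) = h' (\<iota> r)"
    and c: "c \<in> carrier C"
  shows "h c = h' c"
proof -
  interpret crossed_module F C \<delta> act by fact
  have iota: "\<iota> r \<in> carrier C" if "r \<in> R" for r using that assms(4) by auto
  have res: "crossed_module_hom F C \<delta> act M \<mu> act' (restrict k (carrier C))"
    if "crossed_module_hom F C \<delta> act M \<mu> act' k" for k
    using that by (auto simp: crossed_module_hom_def hom_def act_closed)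
  have "h \<in> hom C M" using h by (simp add: crossed_module_hom_def)
  then have "(\<lambda>r. h (\<iota> r)) \<in> R \<rightarrow> carrier M" using iota by (auto simp: hom_def)
  moreover have "\<mu> (h (\<iota> r)) = \<omega> r" if "r \<in> R" for r
    using that h(1) iota assms(5) by (auto simp: crossed_module_hom_def)
  ultimately have "\<exists>\<^sub>\<le>\<^sub>1k. k \<in> extensional (carrier C) \<and> crossed_module_hom F C \<delta> act M \<mu> act' k \<and>
      (\<forall>r\<in>R. k (\<iota> r) = h (\<iota> r))"
    using initial_crossed_module_ex1[OF init M] unfolding ex1_iff_ex_Uniq by blast
  then have "restrict h (carrier C) = restrict h' (carrier C)"
    by (rule Uniq_D) (simp_all add: res h iota eq)
  then have "restrict h (carrier C) c = restrict h' (carrier C) c" by simp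
  then show ?thesis using c by simp
qed

theorem free_crossed_module_universal:
  fixes C :: "'c monoid" and \<omega> :: "'r \<Rightarrow> 'f"
  assumes free: "free_crossed_module F R \<omega> C \<delta> act \<iota>"
  shows "initial_crossed_module TYPE('m) F R \<omega> C \<delta> act \<iota>"
  unfolding initial_crossed_module_def
proof (intro allI impI)
  fix M :: "'m monoid" and \<mu> act' f
  assume a: "crossed_module F M \<mu> act' \<and> f \<in> R \<rightarrow> carrier M \<and> (\<forall>r\<in>R. \<mu> (f r) = \<omega> r)"
  have C: "crossed_module F C \<delta> act" and iota: "\<iota> \<in> R \<rightarrow> carrier C" "\<And>r. r \<in> R \<Longrightarrow> \<delta> (\<iota> r) = \<omega> r"
    and iC: "initial_crossed_module TYPE('c) F R \<omega> C \<delta> act \<iota>"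
    and iK: "initial_crossed_module TYPE(('r \<times> 'f) word set) F R \<omega> C \<delta> act \<iota>"
    using free by (auto simp: free_crossed_module_def)
  interpret C: crossed_module F C \<delta> act by fact
  interpret K: standard_crossed_module F R \<omega>
  proof
    show "\<omega> \<in> R \<rightarrow> carrier F"
      using iota C.mu_hom hom_in_carrier by (fastforce simp: Pi_iff)
  qed
  note K = K.free_crossed_module_standard[unfolded free_crossed_module_def]
  obtain p where p: "crossed_module_hom F C \<delta> act K.std_carrier K.std_boundary K.std_act p"
      "\<And>r. r \<in> R \<Longrightarrow> p (\<iota> r) = K.std_incl r"
    using initial_crossed_module_exists[OF iK, of K.std_carrier K.std_boundary K.std_act K.std_incl] K
    by blast
  obtain q where q: "crossed_module_hom F K.std_carrier K.std_boundary K.std_act C \<delta> act q"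
      "\<And>r. r \<in> R \<Longrightarrow> q (K.std_incl r) = \<iota> r"
    using initial_crossed_module_exists[OF K.std_initial C iota] by blast
  have qp: "q (p c) = c" if "c \<in> carrier C" for c
  proof -
    have "crossed_module_hom F C \<delta> act C \<delta> act (\<lambda>c. c)" by (simp add: crossed_module_hom_def hom_def)
    from initial_crossed_module_unique[OF iC C C iota crossed_module_hom_comp[OF p(1) q(1)] this _ that]
    show ?thesis by (simp add: p q)
  qed
  obtain k where k: "crossed_module_hom F K.std_carrier K.std_boundary K.std_act M \<mu> act' k"
      "\<And>r. r \<in> R \<Longrightarrow> k (K.std_incl r) = f r"
    using initial_crossed_module_exists[OF K.std_initial, of M \<mu> act' f] a by blast
  let ?Q = "\<lambda>h. h \<in> extensional (carrier C) \<and> crossed_module_hom F C \<delta> act M \<mu> act' h \<and>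
    (\<forall>r\<in>R. h (\<iota> r) = f r)"
  show "\<exists>!h. ?Q h"
  proof (rule ex1I)
    have "crossed_module_hom F C \<delta> act M \<mu> act' (restrict (k \<circ> p) (carrier C))"
      using crossed_module_hom_comp[OF p(1) k(1)]
      by (auto simp: crossed_module_hom_def hom_def C.act_closed)
    then show "?Q (restrict (k \<circ> p) (carrier C))" using iota k p by auto
    fix h assume h: "?Q h"
    show "h = restrict (k \<circ> p) (carrier C)"
    proof (rule extensionalityI)
      fix c assume c: "c \<in> carrier C"
      have pc: "p c \<in> carrier K.std_carrier"
        using p(1) c hom_in_carrier by (fastforce simp: crossed_module_hom_def)
      have hq: "crossed_module_hom F K.std_carrier K.std_boundary K.std_act M \<mu> act' (h \<circ> q)"
        using h crossed_module_hom_comp[OF q(1)] by blast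
      have "(h \<circ> q) (p c) = k (p c)"
        by (rule initial_crossed_module_unique[OF K.std_initial _ _ _ _ hq k(1) _ pc])
           (use K a h in \<open>auto simp: q k\<close>)
      then show "h c = restrict (k \<circ> p) (carrier C) c" using c by (simp add: qp)
    qed (use h in auto)
  qed
qed


section \<open>The module of identities among relations\<close>

locale right_gmodule = M: comm_group M + G: group G
  for G :: "('g, 'e) monoid_scheme" and M :: "('m, 'd) monoid_scheme" +
  fixes act :: "'m \<Rightarrow> 'g \<Rightarrow> 'm"
  assumes act_closed: "m \<in> carrier M \<Longrightarrow> g \<in> carrier G \<Longrightarrow> act m g \<in> carrier M"
    and act_mult: "m \<in> carrier M \<Longrightarrow> n \<in> carrier M \<Longrightarrow> g \<in> carrier G \<Longrightarrow>
      act (m \<otimes>\<^bsub>M\<^esub> n) g = act m g \<otimes>\<^bsub>M\<^esub> act n g"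
    and act_one: "m \<in> carrier M \<Longrightarrow> act m \<one>\<^bsub>G\<^esub> = m"
    and act_comp: "m \<in> carrier M \<Longrightarrow> g \<in> carrier G \<Longrightarrow> h \<in> carrier G \<Longrightarrow>
      act (act m g) h = act m (g \<otimes>\<^bsub>G\<^esub> h)"

definition submodule_generated ::
  "('g, 'e) monoid_scheme \<Rightarrow> ('m, 'd) monoid_scheme \<Rightarrow> ('m \<Rightarrow> 'g \<Rightarrow> 'm) \<Rightarrow> 'm set \<Rightarrow> 'm set" where
  "submodule_generated G M act S =
    \<Inter>{N. subgroup N M \<and> S \<subseteq> N \<and> (\<forall>n\<in>N. \<forall>g\<in>carrier G. act n g \<in> N)}"

definition generated_as_gmodule ::
  "('g, 'e) monoid_scheme \<Rightarrow> ('m, 'd) monoid_scheme \<Rightarrow> ('m \<Rightarrow> 'g \<Rightarrow> 'm) \<Rightarrow> 'm set \<Rightarrow> bool" where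
  "generated_as_gmodule G M act S \<longleftrightarrow>
    right_gmodule G M act \<and> S \<subseteq> carrier M \<and> submodule_generated G M act S = carrier M"

definition identities_among_relations ::
  "('f, 'e) monoid_scheme \<Rightarrow> 'c monoid \<Rightarrow> ('c \<Rightarrow> 'f) \<Rightarrow> 'c monoid" where
  "identities_among_relations F C \<delta> = C\<lparr>carrier := kernel C F \<delta>\<rparr>"

text \<open>The action of \<open>g\<close> is that of an arbitrarily chosen preimage of \<open>g\<close> under \<open>\<phi>\<close>; by the lemma
  \<open>induced_act_eq\<close> below the choice does not matter.\<close>

definition induced_act ::
  "('f, 'e) monoid_scheme \<Rightarrow> ('f \<Rightarrow> 'g) \<Rightarrow> ('c \<Rightarrow> 'f \<Rightarrow> 'c) \<Rightarrow> 'c \<Rightarrow> 'g \<Rightarrow> 'c" where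
  "induced_act F \<phi> act c g = act c (inv_into (carrier F) \<phi> g)"

context crossed_module
begin

lemma mu_closed [simp]: "m \<in> carrier M \<Longrightarrow> \<mu> m \<in> carrier F"
  using mu_hom hom_in_carrier by fastforce

sublocale mu: group_hom M F \<mu>
  by unfold_locales (rule mu_hom)

lemma kernel_commute:
  assumes "c \<in> kernel M F \<mu>" "m \<in> carrier M"
  shows "c \<otimes>\<^bsub>M\<^esub> m = m \<otimes>\<^bsub>M\<^esub> c"
proof -
  have c: "c \<in> carrier M" "\<mu> c = \<one>\<^bsub>F\<^esub>" using assms(1) by (auto simp: kernel_def)
  then have "inv\<^bsub>M\<^esub> c \<otimes>\<^bsub>M\<^esub> m \<otimes>\<^bsub>M\<^esub> c = m" using peiffer[OF assms(2), of c] assms(2) by (simp add: act_one)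
  then have "c \<otimes>\<^bsub>M\<^esub> (inv\<^bsub>M\<^esub> c \<otimes>\<^bsub>M\<^esub> m \<otimes>\<^bsub>M\<^esub> c) = c \<otimes>\<^bsub>M\<^esub> m" by simp
  then show ?thesis using c assms(2) by (simp add: M.m_assoc[symmetric])
qed

lemma kernel_act_closed:
  assumes "c \<in> kernel M F \<mu>" "u \<in> carrier F"
  shows "act c u \<in> kernel M F \<mu>"
  using assms by (auto simp: kernel_def act_closed equivariant)

lemma kernel_act_image:
  assumes c: "c \<in> kernel M F \<mu>" and m: "m \<in> carrier M"
  shows "act c (\<mu> m) = c"
proof -
  have "c \<in> carrier M" using c by (simp add: kernel_def)
  then show ?thesis
    using m by (simp add: peiffer[symmetric] M.m_assoc kernel_commute[OF c])
      (simp add: M.m_assoc[symmetric])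
qed

lemma image_normal: "\<mu> ` carrier M \<lhd> F"
proof (rule F.normal_invI)
  show "subgroup (\<mu> ` carrier M) F" by (rule mu.img_is_subgroup)
  fix x h assume x: "x \<in> carrier F" and "h \<in> \<mu> ` carrier M"
  then obtain m where m: "m \<in> carrier M" "h = \<mu> m" by auto
  then have "x \<otimes>\<^bsub>F\<^esub> h \<otimes>\<^bsub>F\<^esub> inv\<^bsub>F\<^esub> x = \<mu> (act m (inv\<^bsub>F\<^esub> x))" using x by (simp add: equivariant)
  then show "x \<otimes>\<^bsub>F\<^esub> h \<otimes>\<^bsub>F\<^esub> inv\<^bsub>F\<^esub> x \<in> \<mu> ` carrier M" using m x by (simp add: act_closed)
qed

end

context group_presentation
begin

lemma induced_act_eq:
  assumes free: "free_crossed_module (free_group X) R \<omega> C \<delta> act \<iota>"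
    and c: "c \<in> kernel C (free_group X) \<delta>" and u: "u \<in> carrier (free_group X)"
  shows "induced_act (free_group X) \<phi> act c (\<phi> u) = act c u"
proof -
  let ?F = "free_group X"
  interpret crossed_module ?F C \<delta> act using free by (simp add: free_crossed_module_def)
  interpret phi: group_hom ?F G \<phi>
    using phi by unfold_locales (simp add: epi_def)
  have cC: "c \<in> carrier C" using c by (simp add: kernel_def)
  define v where "v = inv_into (carrier ?F) \<phi> (\<phi> u)"
  have v: "v \<in> carrier ?F" "\<phi> v = \<phi> u"
    unfolding v_def using u by (auto intro: inv_into_into f_inv_into_f)
  have "\<omega> ` R \<subseteq> \<delta> ` carrier C"
    using free by (force simp: free_crossed_module_def)
  then have "normal_closure ?F (\<omega> ` R) \<subseteq> \<delta> ` carrier C"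
    using image_normal by (auto simp: normal_closure_def)
  moreover have "u \<otimes>\<^bsub>?F\<^esub> inv\<^bsub>?F\<^esub> v \<in> kernel ?F G \<phi>"
    using u v by (simp add: kernel_def)
  ultimately obtain n where n: "n \<in> carrier C" "u \<otimes>\<^bsub>?F\<^esub> inv\<^bsub>?F\<^esub> v = \<delta> n"
    using kernel_phi by auto
  have "act c u = act c (\<delta> n \<otimes>\<^bsub>?F\<^esub> v)"
    using u v by (simp add: n(2)[symmetric] F.m_assoc)
  also have "\<dots> = act (act c (\<delta> n)) v" using act_comp[OF cC, of "\<delta> n" v] n(1) v(1) by simp
  also have "\<dots> = act c v" using kernel_act_image[OF c n(1)] by simp
  finally show ?thesis by (simp add: induced_act_def v_def)
qed

theorem identities_right_gmodule:
  assumes free: "free_crossed_module (free_group X) R \<omega> C \<delta> act \<iota>"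
  shows "right_gmodule G (identities_among_relations (free_group X) C \<delta>)
    (induced_act (free_group X) \<phi> act)"
proof -
  let ?F = "free_group X"
  let ?P = "identities_among_relations ?F C \<delta>"
  interpret crossed_module ?F C \<delta> act using free by (simp add: free_crossed_module_def)
  interpret phi: group_hom ?F G \<phi>
    using phi by unfold_locales (simp add: epi_def)
  have carr: "carrier ?P = kernel C ?F \<delta>" by (simp add: identities_among_relations_def)
  have mult: "x \<otimes>\<^bsub>?P\<^esub> y = x \<otimes>\<^bsub>C\<^esub> y" for x y by (simp add: identities_among_relations_def)
  have surj: "\<exists>u\<in>carrier ?F. g = \<phi> u" if "g \<in> carrier G" for g
    using that phi by (auto simp: epi_def)
  have sub: "subgroup (kernel C ?F \<delta>) C" by (rule mu.subgroup_kernel)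
  have kC: "c \<in> carrier C" if "c \<in> kernel C ?F \<delta>" for c using that by (simp add: kernel_def)
  have kmult: "c \<otimes>\<^bsub>C\<^esub> d \<in> kernel C ?F \<delta>" if "c \<in> kernel C ?F \<delta>" "d \<in> kernel C ?F \<delta>" for c d
    using sub that by (rule subgroup.m_closed)
  interpret P: group ?P
    unfolding identities_among_relations_def
    by (rule subgroup.subgroup_is_group[OF sub M.group_axioms])
  show ?thesis
  proof (intro right_gmodule.intro right_gmodule_axioms.intro)
    show "comm_group ?P"
      by (rule P.group_comm_groupI) (simp add: carr mult kernel_commute kC)
    show "group G" by (rule group_axioms)
  next
    fix m g assume "m \<in> carrier ?P" "g \<in> carrier G"
    then show "induced_act ?F \<phi> act m g \<in> carrier ?P"
      using surj[of g] by (auto simp: carr induced_act_eq[OF free] kernel_act_closed)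
  next
    fix m n g assume "m \<in> carrier ?P" "n \<in> carrier ?P" "g \<in> carrier G"
    then show "induced_act ?F \<phi> act (m \<otimes>\<^bsub>?P\<^esub> n) g = induced_act ?F \<phi> act m g \<otimes>\<^bsub>?P\<^esub> induced_act ?F \<phi> act n g"
      using surj[of g] by (auto simp: carr mult induced_act_eq[OF free] kmult kC act_mult)
  next
    fix m assume m: "m \<in> carrier ?P"
    then show "induced_act ?F \<phi> act m \<one> = m"
      using induced_act_eq[OF free, of m "\<one>\<^bsub>?F\<^esub>"] by (simp add: carr kC act_one)
  next
    fix m g h assume m: "m \<in> carrier ?P" and "g \<in> carrier G" "h \<in> carrier G"
    then obtain u v where uv: "u \<in> carrier ?F" "g = \<phi> u" "v \<in> carrier ?F" "h = \<phi> v"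
      using surj by metis
    then have "g \<otimes> h = \<phi> (u \<otimes>\<^bsub>?F\<^esub> v)" by simp
    then show "induced_act ?F \<phi> act (induced_act ?F \<phi> act m g) h = induced_act ?F \<phi> act m (g \<otimes> h)"
      using m uv by (simp add: carr induced_act_eq[OF free] kernel_act_closed act_comp kC del: phi.hom_mult)
  qed
qed

end

section \<open>Groupoids\<close>

record ('o, 'a) groupoid =
  obj :: "'o set"
  arr :: "'a set"
  src :: "'a \<Rightarrow> 'o"
  tgt :: "'a \<Rightarrow> 'o"
  ident :: "'o \<Rightarrow> 'a"
  Comp :: "'a \<Rightarrow> 'a \<Rightarrow> 'a"

text \<open>\<open>Comp \<A> a b\<close> is the composite \<open>ab : x \<rightarrow> z\<close> of \<open>a : x \<rightarrow> y\<close> and \<open>b : y \<rightarrow> z\<close>.\<close>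

definition is_groupoid :: "('o, 'a) groupoid \<Rightarrow> bool" where
  "is_groupoid \<A> \<longleftrightarrow>
    src \<A> \<in> arr \<A> \<rightarrow> obj \<A> \<and> tgt \<A> \<in> arr \<A> \<rightarrow> obj \<A> \<and>
    (\<forall>x\<in>obj \<A>. ident \<A> x \<in> arr \<A> \<and> src \<A> (ident \<A> x) = x \<and> tgt \<A> (ident \<A> x) = x) \<and>
    (\<forall>a\<in>arr \<A>. \<forall>b\<in>arr \<A>. tgt \<A> a = src \<A> b \<longrightarrow>
      Comp \<A> a b \<in> arr \<A> \<and> src \<A> (Comp \<A> a b) = src \<A> a \<and> tgt \<A> (Comp \<A> a b) = tgt \<A> b) \<and>
    (\<forall>a\<in>arr \<A>. Comp \<A> (ident \<A> (src \<A> a)) a = a \<and> Comp \<A> a (ident \<A> (tgt \<A> a)) = a) \<and>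
    (\<forall>a\<in>arr \<A>. \<forall>b\<in>arr \<A>. \<forall>c\<in>arr \<A>. tgt \<A> a = src \<A> b \<and> tgt \<A> b = src \<A> c \<longrightarrow>
      Comp \<A> (Comp \<A> a b) c = Comp \<A> a (Comp \<A> b c)) \<and>
    (\<forall>a\<in>arr \<A>. \<exists>b\<in>arr \<A>. src \<A> b = tgt \<A> a \<and> tgt \<A> b = src \<A> a \<and>
      Comp \<A> a b = ident \<A> (src \<A> a) \<and> Comp \<A> b a = ident \<A> (tgt \<A> a))"

definition groupoid_morphism ::
  "('o, 'a) groupoid \<Rightarrow> ('p, 'b) groupoid \<Rightarrow> ('o \<Rightarrow> 'p) \<Rightarrow> ('a \<Rightarrow> 'b) \<Rightarrow> bool" where
  "groupoid_morphism \<A> \<B> f0 f1 \<longleftrightarrow>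
    f0 \<in> obj \<A> \<rightarrow> obj \<B> \<and> f1 \<in> arr \<A> \<rightarrow> arr \<B> \<and>
    (\<forall>a\<in>arr \<A>. src \<B> (f1 a) = f0 (src \<A> a) \<and> tgt \<B> (f1 a) = f0 (tgt \<A> a)) \<and>
    (\<forall>x\<in>obj \<A>. f1 (ident \<A> x) = ident \<B> (f0 x)) \<and>
    (\<forall>a\<in>arr \<A>. \<forall>b\<in>arr \<A>. tgt \<A> a = src \<A> b \<longrightarrow> f1 (Comp \<A> a b) = Comp \<B> (f1 a) (f1 b))"

definition one_object_groupoid :: "('c, 'e) monoid_scheme \<Rightarrow> (unit, 'c) groupoid" where
  "one_object_groupoid C =
    \<lparr>obj = UNIV, arr = carrier C, src = (\<lambda>_. ()), tgt = (\<lambda>_. ()), ident = (\<lambda>_. \<one>\<^bsub>C\<^esub>), Comp = mult C\<rparr>"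

text \<open>The arrow \<open>(g, x)\<close> of the Cayley graph is the arrow \<open>(g, free_gen X x)\<close> of this groupoid.\<close>

definition cayley_free_groupoid ::
  "('g, 'e) monoid_scheme \<Rightarrow> 'x set \<Rightarrow> ('x word set \<Rightarrow> 'g) \<Rightarrow> ('g, 'g \<times> 'x word set) groupoid" where
  "cayley_free_groupoid G X \<phi> =
    \<lparr>obj = carrier G, arr = carrier G \<times> carrier (free_group X),
     src = fst, tgt = (\<lambda>(g, u). g \<otimes>\<^bsub>G\<^esub> \<phi> u),
     ident = (\<lambda>g. (g, \<one>\<^bsub>free_group X\<^esub>)),
     Comp = (\<lambda>(g, u) (_, v). (g, u \<otimes>\<^bsub>free_group X\<^esub> v))\<rparr>"

lemma is_groupoid_one_object: "group C \<Longrightarrow> is_groupoid (one_object_groupoid C)"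
proof -
  assume "group C"
  then interpret group C .
  have "\<exists>b\<in>carrier C. a \<otimes>\<^bsub>C\<^esub> b = \<one>\<^bsub>C\<^esub> \<and> b \<otimes>\<^bsub>C\<^esub> a = \<one>\<^bsub>C\<^esub>" if "a \<in> carrier C" for a
    using that by (intro bexI[of _ "inv\<^bsub>C\<^esub> a"]) auto
  then show ?thesis by (auto simp: is_groupoid_def one_object_groupoid_def m_assoc)
qed

lemma (in group_presentation) is_groupoid_cayley: "is_groupoid (cayley_free_groupoid G X \<phi>)"
proof -
  let ?F = "free_group X"
  interpret F: group ?F by (rule presented_group_group)
  interpret phi: group_hom ?F G \<phi>
    using phi by unfold_locales (simp add: epi_def)
  have "\<exists>h\<in>carrier G. \<exists>v\<in>carrier ?F. h = g \<otimes> \<phi> u \<and> h \<otimes> \<phi> v = g \<and>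
      u \<otimes>\<^bsub>?F\<^esub> v = \<one>\<^bsub>?F\<^esub> \<and> v \<otimes>\<^bsub>?F\<^esub> u = \<one>\<^bsub>?F\<^esub>"
    if "g \<in> carrier G" "u \<in> carrier ?F" for g u
    using that by (intro bexI[of _ "g \<otimes> \<phi> u"] bexI[of _ "inv\<^bsub>?F\<^esub> u"]) (simp_all add: m_assoc)
  then show ?thesis
    by (fastforce simp: is_groupoid_def cayley_free_groupoid_def m_assoc F.m_assoc)
qed

end

theory Submission
  imports Defs
begin

text \<open>For \<open>g\<close> in \<open>G\<close> and \<open>c\<close> in \<open>C(R)\<close> put \<open>d\<^sub>g c = (k\<^sub>1 (g, \<delta>\<^sub>2 c))\<inverse> c^((\<sigma> g)\<inverse>)\<close>, so that
  \<open>d\<^sub>g r = \<delta>\<^sub>3[g, r]\<close>.  Since \<open>\<delta>\<^sub>2 k\<^sub>1 (g, u) = (\<sigma> g) u (\<sigma> (g (\<phi> u)))\<inverse>\<close> for all \<open>u\<close> in \<open>F(X)\<close>, each \<open>d\<^sub>g\<close> takes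
  values in the central subgroup \<open>\<pi>(\<P>)\<close> and is therefore a homomorphism.  The Peiffer identity gives
  \<open>d\<^sub>g (c^u) = (d\<^sub>h c)^((\<sigma> h) u (\<sigma> g)\<inverse>)\<close>, where \<open>h = g (\<phi> u)\<inverse>\<close>.  Hence for a submodule \<open>N\<close>
  containing all \<open>\<delta>\<^sub>3[g, r]\<close> the elements \<open>c\<close> with \<open>d\<^sub>g c \<in> N\<close> for all \<open>g\<close> form a sub-crossed-module
  containing \<open>R\<close>, which is all of \<open>C(R)\<close>.  On \<open>\<pi>(\<P>)\<close> itself \<open>d\<^sub>g\<close> is the action of \<open>g\<inverse>\<close>.\<close>

lemma (in crossed_module) act_hom: "u \<in> carrier F \<Longrightarrow> group_hom M M (\<lambda>m. act m u)"
  by unfold_locales (auto intro!: homI simp: act_closed act_mult)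

lemma (in crossed_module) act_inv:
  "m \<in> carrier M \<Longrightarrow> u \<in> carrier F \<Longrightarrow> act (inv\<^bsub>M\<^esub> m) u = inv\<^bsub>M\<^esub> act m u"
  using group_hom.hom_inv[OF act_hom] by simp

lemma (in crossed_module) crossed_submodule:
  assumes H: "subgroup H M" and act: "\<And>m u. m \<in> H \<Longrightarrow> u \<in> carrier F \<Longrightarrow> act m u \<in> H"
  shows "crossed_module F (M\<lparr>carrier := H\<rparr>) \<mu> act"
proof -
  interpret H: subgroup H M by fact
  interpret HG: group "M\<lparr>carrier := H\<rparr>" by (rule H.subgroup_is_group) (rule M.group_axioms)
  show ?thesis
  proof
    show "\<mu> \<in> hom (M\<lparr>carrier := H\<rparr>) F" by (rule homI) (simp_all add: H.mem_carrier)
    show "inv\<^bsub>M\<lparr>carrier := H\<rparr>\<^esub> n \<otimes>\<^bsub>M\<lparr>carrier := H\<rparr>\<^esub> m \<otimes>\<^bsub>M\<lparr>carrier := H\<rparr>\<^esub> n = act m (\<mu> n)"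
      if "m \<in> carrier (M\<lparr>carrier := H\<rparr>)" "n \<in> carrier (M\<lparr>carrier := H\<rparr>)" for m n
      using that M.m_inv_consistent[OF H, of n] by (simp add: H.mem_carrier peiffer)
  qed (simp_all add: act H.mem_carrier act_mult act_one act_comp equivariant)
qed

text \<open>Initiality gives a crossed module map \<open>h\<close> from \<open>C\<close> to the
  sub-crossed-module on \<open>H\<close> that fixes every \<open>\<iota> r\<close>. Followed by the
  inclusion it agrees with the identity on these elements, so by uniqueness \<open>h c = c\<close>,
  which lies in \<open>H\<close>. As \<open>H\<close> has the element type of \<open>C\<close>, the
  \<open>'c\<close> clause of \<open>free_crossed_module\<close> applies.\<close>

lemma free_crossed_module_generated:
  fixes C :: "'c monoid"
  assumes free: "free_crossed_module F R \<omega> C \<delta> act \<iota>"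
    and H: "subgroup H C" and act: "\<And>c u. c \<in> H \<Longrightarrow> u \<in> carrier F \<Longrightarrow> act c u \<in> H"
    and gens: "\<iota> ` R \<subseteq> H"
  shows "H = carrier C"
proof
  show "H \<subseteq> carrier C" using H by (rule subgroup.subset)
  show "carrier C \<subseteq> H"
  proof
    fix c assume c: "c \<in> carrier C"
    have C: "crossed_module F C \<delta> act" and iota: "\<iota> \<in> R \<rightarrow> carrier C" "\<And>r. r \<in> R \<Longrightarrow> \<delta> (\<iota> r) = \<omega> r"
      and init: "initial_crossed_module TYPE('c) F R \<omega> C \<delta> act \<iota>"
      using free by (auto simp: free_crossed_module_def)
    let ?H = "C\<lparr>carrier := H\<rparr>"
    have "crossed_module F ?H \<delta> act" by (rule crossed_module.crossed_submodule[OF C H act])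
    moreover have "\<iota> \<in> R \<rightarrow> carrier ?H" using gens by auto
    ultimately obtain h where h: "crossed_module_hom F C \<delta> act ?H \<delta> act h" "\<And>r. r \<in> R \<Longrightarrow> h (\<iota> r) = \<iota> r"
      using initial_crossed_module_exists[OF init, of ?H \<delta> act \<iota>] iota(2) by blast
    have "crossed_module_hom F C \<delta> act C \<delta> act h"
      using h(1) subgroup.mem_carrier[OF H] by (auto simp: crossed_module_hom_def hom_def)
    moreover have "crossed_module_hom F C \<delta> act C \<delta> act (\<lambda>c. c)"
      by (simp add: crossed_module_hom_def hom_def)
    ultimately have "h c = c"
      using initial_crossed_module_unique[OF init C C iota _ _ _ c] h(2) by blast
    moreover have "h c \<in> H" using h(1) c by (auto simp: crossed_module_hom_def hom_def)
    ultimately show "c \<in> H" by simp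
  qed
qed

locale presentation_section = group_presentation +
  fixes C :: "'c monoid" and \<delta>\<^sub>2 act \<iota> \<sigma> k\<^sub>1
  assumes free: "free_crossed_module (free_group X) R \<omega> C \<delta>\<^sub>2 act \<iota>"
    and sigma: "\<sigma> \<in> carrier G \<rightarrow> carrier (free_group X)"
    and phi_sigma: "g \<in> carrier G \<Longrightarrow> \<phi> (\<sigma> g) = g"
    and k1: "groupoid_morphism (cayley_free_groupoid G X \<phi>) (one_object_groupoid C) (\<lambda>_. ()) k\<^sub>1"
    and boundary_k1_gen: "g \<in> carrier G \<Longrightarrow> x \<in> X \<Longrightarrow>
      \<delta>\<^sub>2 (k\<^sub>1 (g, free_gen X x)) =
        \<sigma> g \<otimes>\<^bsub>free_group X\<^esub> free_gen X x
          \<otimes>\<^bsub>free_group X\<^esub> inv\<^bsub>free_group X\<^esub> (\<sigma> (g \<otimes> \<phi> (free_gen X x)))"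
begin

abbreviation "\<F> \<equiv> free_group X"
abbreviation "\<I> \<equiv> identities_among_relations \<F> C \<delta>\<^sub>2"

sublocale C: crossed_module \<F> C \<delta>\<^sub>2 act
  using free by (simp add: free_crossed_module_def)

sublocale phi: group_hom \<F> G \<phi>
  using phi by unfold_locales (simp add: epi_def)

text \<open>The map d_g of the opening comment. It compares two lifts to \<open>C\<close> of the
  conjugate of \<open>\<delta>\<^sub>2 c\<close> by \<open>\<sigma> g\<close>.\<close>

definition
  "defect g c = inv\<^bsub>C\<^esub> (k\<^sub>1 (g, \<delta>\<^sub>2 c)) \<otimes>\<^bsub>C\<^esub> act c (inv\<^bsub>\<F>\<^esub> (\<sigma> g))"

lemma iota_closed [simp]: "r \<in> R \<Longrightarrow> \<iota> r \<in> carrier C"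
  and boundary_iota [simp]: "r \<in> R \<Longrightarrow> \<delta>\<^sub>2 (\<iota> r) = \<omega> r"
  using free by (auto simp: free_crossed_module_def)

lemma sigma_closed [simp]: "g \<in> carrier G \<Longrightarrow> \<sigma> g \<in> carrier \<F>"
  using sigma by auto

lemma k1_closed [simp]: "g \<in> carrier G \<Longrightarrow> u \<in> carrier \<F> \<Longrightarrow> k\<^sub>1 (g, u) \<in> carrier C"
  using k1 by (auto simp: groupoid_morphism_def cayley_free_groupoid_def one_object_groupoid_def)

lemma k1_one: "g \<in> carrier G \<Longrightarrow> k\<^sub>1 (g, \<one>\<^bsub>\<F>\<^esub>) = \<one>\<^bsub>C\<^esub>"
  using k1 by (auto simp: groupoid_morphism_def cayley_free_groupoid_def one_object_groupoid_def)

lemma k1_mult: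
  "g \<in> carrier G \<Longrightarrow> u \<in> carrier \<F> \<Longrightarrow> v \<in> carrier \<F> \<Longrightarrow>
    k\<^sub>1 (g, u \<otimes>\<^bsub>\<F>\<^esub> v) = k\<^sub>1 (g, u) \<otimes>\<^bsub>C\<^esub> k\<^sub>1 (g \<otimes> \<phi> u, v)"
  using k1 by (auto simp: groupoid_morphism_def cayley_free_groupoid_def one_object_groupoid_def)

text \<open>The arrow \<open>(g, inv u)\<close> ends at \<open>g \<otimes> inv (\<phi> u)\<close>,
  where its inverse arrow, with label \<open>u\<close>, starts.\<close>

lemma k1_inv:
  assumes "g \<in> carrier G" "u \<in> carrier \<F>"
  shows "k\<^sub>1 (g, inv\<^bsub>\<F>\<^esub> u) = inv\<^bsub>C\<^esub> (k\<^sub>1 (g \<otimes> inv (\<phi> u), u))"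
proof -
  have "k\<^sub>1 (g, inv\<^bsub>\<F>\<^esub> u) \<otimes>\<^bsub>C\<^esub> k\<^sub>1 (g \<otimes> inv (\<phi> u), u) = \<one>\<^bsub>C\<^esub>"
    using assms k1_mult[of g "inv\<^bsub>\<F>\<^esub> u" u] by (simp add: k1_one)
  then show ?thesis using assms by (simp add: C.M.inv_equality)
qed

text \<open>The right-hand side is multiplicative along composable arrows, since the inner values of
  \<open>\<sigma>\<close> cancel; so the generators decide. The vertex \<open>g\<close> must vary in
  the induction because the second factor of a product starts at
  \<open>g \<otimes> \<phi> u\<close>.\<close>

lemma boundary_k1:
  assumes "u \<in> carrier \<F>" "g \<in> carrier G"
  shows "\<delta>\<^sub>2 (k\<^sub>1 (g, u)) = \<sigma> g \<otimes>\<^bsub>\<F>\<^esub> u \<otimes>\<^bsub>\<F>\<^esub> inv\<^bsub>\<F>\<^esub> (\<sigma> (g \<otimes> \<phi> u))"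
  using assms
proof (induction arbitrary: g rule: presented_group_induct)
  case one
  then show ?case by (simp add: k1_one)
next
  case (gen x)
  then show ?case by (simp add: boundary_k1_gen)
next
  case (inv x)
  then show ?case
    by (simp add: k1_inv boundary_k1_gen C.F.inv_mult_group C.F.m_assoc m_assoc)
next
  case (mult u v)
  have "inv\<^bsub>\<F>\<^esub> a \<otimes>\<^bsub>\<F>\<^esub> (a \<otimes>\<^bsub>\<F>\<^esub> b) = b" if "a \<in> carrier \<F>" "b \<in> carrier \<F>" for a b
    using that by (simp add: C.F.m_assoc[symmetric])
  with mult show ?case by (simp add: k1_mult C.F.m_assoc m_assoc)
qed

text \<open>This makes \<open>(g, \<delta>\<^sub>2 c)\<close> a loop at \<open>g\<close>: both
  values of \<open>\<sigma>\<close> in \<open>boundary_k1\<close> are then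
  \<open>\<sigma> g\<close>, and \<open>k\<^sub>1 (g, _)\<close> is multiplicative on
  boundaries.\<close>

lemma phi_boundary:
  assumes "c \<in> carrier C"
  shows "\<phi> (\<delta>\<^sub>2 c) = \<one>"
proof -
  let ?H = "{c \<in> carrier C. \<phi> (\<delta>\<^sub>2 c) = \<one>}"
  have "?H = carrier C"
  proof (rule free_crossed_module_generated[OF free])
    show "subgroup ?H C" by (rule C.M.subgroupI) auto
    have "\<omega> ` R \<subseteq> kernel \<F> G \<phi>"
      unfolding kernel_phi by (auto simp: normal_closure_def)
    then show "\<iota> ` R \<subseteq> ?H" by (auto simp: kernel_def)
  qed (auto simp: C.act_closed C.equivariant)
  with assms show ?thesis by blast
qed

lemma defect_kernel:
  assumes "g \<in> carrier G" "c \<in> carrier C"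
  shows "defect g c \<in> kernel C \<F> \<delta>\<^sub>2"
  using assms
  by (simp add: defect_def kernel_def C.act_closed C.equivariant boundary_k1 phi_boundary C.F.m_assoc)

lemma defect_closed [simp]: "g \<in> carrier G \<Longrightarrow> c \<in> carrier C \<Longrightarrow> defect g c \<in> carrier C"
  using defect_kernel by (simp add: kernel_def)

lemma defect_hom:
  assumes g: "g \<in> carrier G"
  shows "group_hom C C (defect g)"
proof unfold_locales
  show "defect g \<in> hom C C"
  proof (rule homI)
    fix c d assume c: "c \<in> carrier C" and d: "d \<in> carrier C"
    let ?k = "\<lambda>c. k\<^sub>1 (g, \<delta>\<^sub>2 c)" and ?a = "\<lambda>c. act c (inv\<^bsub>\<F>\<^esub> (\<sigma> g))"
    have "defect g (c \<otimes>\<^bsub>C\<^esub> d) = inv\<^bsub>C\<^esub> ?k d \<otimes>\<^bsub>C\<^esub> defect g c \<otimes>\<^bsub>C\<^esub> ?a d"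
      using g c d
      by (simp add: defect_def k1_mult phi_boundary C.act_mult C.M.inv_mult_group C.M.m_assoc C.act_closed)
    \<comment> \<open>Inverting the product has put the factor for \<open>d\<close> in front;
      centrality of the kernel moves it back.\<close>
    also have "inv\<^bsub>C\<^esub> ?k d \<otimes>\<^bsub>C\<^esub> defect g c = defect g c \<otimes>\<^bsub>C\<^esub> inv\<^bsub>C\<^esub> ?k d"
      using g c d by (simp add: C.kernel_commute[OF defect_kernel])
    finally show "defect g (c \<otimes>\<^bsub>C\<^esub> d) = defect g c \<otimes>\<^bsub>C\<^esub> defect g d"
      using g c d by (simp add: defect_def[of g d] C.M.m_assoc C.act_closed)
  qed (simp add: g)
qed

lemma defect_act:
  assumes g: "g \<in> carrier G" and c: "c \<in> carrier C" and u: "u \<in> carrier \<F>"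
  defines "h \<equiv> g \<otimes> inv (\<phi> u)"
  shows "defect g (act c u) = act (defect h c) (\<sigma> h \<otimes>\<^bsub>\<F>\<^esub> u \<otimes>\<^bsub>\<F>\<^esub> inv\<^bsub>\<F>\<^esub> (\<sigma> g))"
proof -
  let ?w = "\<sigma> h \<otimes>\<^bsub>\<F>\<^esub> u \<otimes>\<^bsub>\<F>\<^esub> inv\<^bsub>\<F>\<^esub> (\<sigma> g)"
  have h: "h \<in> carrier G" and hu: "h \<otimes> \<phi> u = g" using g u by (simp_all add: h_def m_assoc)
  have w: "?w \<in> carrier \<F>" using g h u by simp
  \<comment> \<open>The boundary of c^u is u^-1 (\<open>\<delta>\<^sub>2 c\<close>) u. The loop it
    labels at \<open>g\<close> goes to \<open>h\<close>, runs around the loop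
    \<open>\<delta>\<^sub>2 c\<close> there and returns along \<open>u\<close>.\<close>
  have "k\<^sub>1 (g, \<delta>\<^sub>2 (act c u)) = inv\<^bsub>C\<^esub> (k\<^sub>1 (h, u)) \<otimes>\<^bsub>C\<^esub> k\<^sub>1 (h, \<delta>\<^sub>2 c) \<otimes>\<^bsub>C\<^esub> k\<^sub>1 (h, u)"
    using g c u h by (simp add: C.equivariant k1_mult k1_inv phi_boundary h_def)
  \<comment> \<open>By the Peiffer identity, conjugation by \<open>k\<^sub>1 (h, u)\<close> is the
    action of its boundary, and that is \<open>?w\<close>.\<close>
  also have "\<dots> = act (k\<^sub>1 (h, \<delta>\<^sub>2 c)) ?w"
    using c u h by (simp add: C.peiffer boundary_k1 hu)
  finally have k: "k\<^sub>1 (g, \<delta>\<^sub>2 (act c u)) = act (k\<^sub>1 (h, \<delta>\<^sub>2 c)) ?w" .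
  \<comment> \<open>The second factor of the defect is also moved from \<open>h\<close> to
    \<open>g\<close> by \<open>?w\<close>.\<close>
  have "inv\<^bsub>\<F>\<^esub> (\<sigma> h) \<otimes>\<^bsub>\<F>\<^esub> ?w = u \<otimes>\<^bsub>\<F>\<^esub> inv\<^bsub>\<F>\<^esub> (\<sigma> g)"
    using g u h by (simp add: C.F.m_assoc[symmetric])
  then have "act (act c u) (inv\<^bsub>\<F>\<^esub> (\<sigma> g)) = act (act c (inv\<^bsub>\<F>\<^esub> (\<sigma> h))) ?w"
    using g c u h w by (simp add: C.act_comp del: C.F.m_closed)
  with k show ?thesis
    using c h w by (simp add: defect_def C.act_mult C.act_inv C.act_closed del: C.F.m_closed)
qed

lemma defect_mem:
  assumes N: "subgroup N \<I>" and iota: "\<And>g r. g \<in> carrier G \<Longrightarrow> r \<in> R \<Longrightarrow> defect g (\<iota> r) \<in> N"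
    and act: "\<And>n u. n \<in> N \<Longrightarrow> u \<in> carrier \<F> \<Longrightarrow> act n u \<in> N"
    and g: "g \<in> carrier G" and c: "c \<in> carrier C"
  shows "defect g c \<in> N"
proof -
  have N': "subgroup N C"
    using C.M.incl_subgroup[OF C.mu.subgroup_kernel] N by (simp add: identities_among_relations_def)
  \<comment> \<open>All \<open>g\<close> are taken at once because \<open>defect_act\<close> trades
    the vertex \<open>g\<close> for another vertex \<open>h\<close>.\<close>
  let ?H = "{c \<in> carrier C. \<forall>g\<in>carrier G. defect g c \<in> N}"
  have "?H = carrier C"
  proof (rule free_crossed_module_generated[OF free])
    have "defect g (c \<otimes>\<^bsub>C\<^esub> d) = defect g c \<otimes>\<^bsub>C\<^esub> defect g d"
        "defect g (inv\<^bsub>C\<^esub> c) = inv\<^bsub>C\<^esub> defect g c"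
      if "g \<in> carrier G" "c \<in> carrier C" "d \<in> carrier C" for g c d
      using that group_hom.hom_mult[OF defect_hom] group_hom.hom_inv[OF defect_hom] by simp_all
    then show "subgroup ?H C"
      by (intro subgroup.intro)
        (auto simp: group_hom.hom_one[OF defect_hom] subgroup.m_closed[OF N']
          subgroup.m_inv_closed[OF N'] subgroup.one_closed[OF N'])
  qed (auto simp: C.act_closed iota defect_act intro!: act)
  with g c show ?thesis by blast
qed

theorem identities_generated:
  "generated_as_gmodule G \<I> (induced_act \<F> \<phi> act) {defect g (\<iota> r) | g r. g \<in> carrier G \<and> r \<in> R}"
  (is "generated_as_gmodule G \<I> ?act ?S")
proof -
  have carr: "carrier \<I> = kernel C \<F> \<delta>\<^sub>2" by (simp add: identities_among_relations_def)
  interpret P: right_gmodule G \<I> ?act by (rule identities_right_gmodule[OF free])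
  have S: "?S \<subseteq> carrier \<I>" by (auto simp: carr defect_kernel)
  have "carrier \<I> \<subseteq> N"
    if N: "subgroup N \<I>" "?S \<subseteq> N" and G_closed: "\<forall>n\<in>N. \<forall>g\<in>carrier G. ?act n g \<in> N" for N
  proof
    fix c assume "c \<in> carrier \<I>"
    then have ck: "c \<in> kernel C \<F> \<delta>\<^sub>2" and c: "c \<in> carrier C" and dc: "\<delta>\<^sub>2 c = \<one>\<^bsub>\<F>\<^esub>"
      by (auto simp: carr kernel_def)
    \<comment> \<open>On the kernel, \<open>u\<close> acts as \<open>\<phi> u\<close> does, so
      stability under \<open>G\<close> gives stability under the free group.\<close>
    have act: "act n u \<in> N" if "n \<in> N" "u \<in> carrier \<F>" for n u
      using that G_closed induced_act_eq[OF free, of n u] subgroup.mem_carrier[OF N(1)] carr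
      by (metis phi.hom_closed)
    \<comment> \<open>A section may send \<open>\<one>\<close> to any element of the kernel of
      \<open>\<phi>\<close>. As \<open>c\<close> has trivial boundary,
      \<open>defect \<one> c\<close> is \<open>c\<close> acted on by the inverse of
      \<open>?s\<close>; acting by \<open>?s\<close> recovers \<open>c\<close>.\<close>
    let ?s = "\<sigma> \<one>"
    have "defect \<one> c \<in> N" by (rule defect_mem[OF N(1)]) (use N(2) act c in auto)
    then have "act (act c (inv\<^bsub>\<F>\<^esub> ?s)) ?s \<in> N"
      using act c by (simp add: defect_def dc k1_one C.act_closed)
    then show "c \<in> N" using c by (simp add: C.act_comp C.act_one)
  qed
  \<comment> \<open>The whole module belongs to the family being intersected, which bounds the
    generated submodule from above.\<close>
  moreover have "subgroup (carrier \<I>) \<I>" by (rule P.M.subgroup_self)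
  ultimately have "submodule_generated G \<I> ?act ?S = carrier \<I>"
    using S P.act_closed unfolding submodule_generated_def
    by (intro equalityI Inter_lower Inter_greatest) auto
  then show ?thesis using S P.right_gmodule_axioms by (simp add: generated_as_gmodule_def)
qed

end

theorem theoremA:
  fixes G :: "('g, 'e) monoid_scheme"
    and X :: "'x set"
    and R :: "'r set"
    and \<omega> :: "'r \<Rightarrow> 'x word set"
    and \<phi> :: "'x word set \<Rightarrow> 'g"
    and C :: "'c monoid"
    and \<delta>\<^sub>2 :: "'c \<Rightarrow> 'x word set"
    and act :: "'c \<Rightarrow> 'x word set \<Rightarrow> 'c"
    and \<iota> :: "'r \<Rightarrow> 'c"
    and \<sigma> :: "'g \<Rightarrow> 'x word set"
    and k\<^sub>1 :: "'g \<times> 'x word set \<Rightarrow> 'c"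
  assumes "group_presentation G X R \<omega> \<phi>"
    and "free_crossed_module (free_group X) R \<omega> C \<delta>\<^sub>2 act \<iota>"
    and "\<sigma> \<in> carrier G \<rightarrow> carrier (free_group X)"
    and "\<And>g. g \<in> carrier G \<Longrightarrow> \<phi> (\<sigma> g) = g"
    and "groupoid_morphism (cayley_free_groupoid G X \<phi>) (one_object_groupoid C) (\<lambda>_. ()) k\<^sub>1"
    and "\<And>g x. g \<in> carrier G \<Longrightarrow> x \<in> X \<Longrightarrow>
      \<delta>\<^sub>2 (k\<^sub>1 (g, free_gen X x)) =
        \<sigma> g \<otimes>\<^bsub>free_group X\<^esub> free_gen X x
          \<otimes>\<^bsub>free_group X\<^esub> inv\<^bsub>free_group X\<^esub> (\<sigma> (g \<otimes>\<^bsub>G\<^esub> \<phi> (free_gen X x)))"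
  shows "generated_as_gmodule G
    (identities_among_relations (free_group X) C \<delta>\<^sub>2)
    (induced_act (free_group X) \<phi> act)
    {inv\<^bsub>C\<^esub> (k\<^sub>1 (g, \<omega> r)) \<otimes>\<^bsub>C\<^esub> act (\<iota> r) (inv\<^bsub>free_group X\<^esub> (\<sigma> g)) | g r. g \<in> carrier G \<and> r \<in> R}"
proof -
  interpret presentation_section G X R \<omega> \<phi> C \<delta>\<^sub>2 act \<iota> \<sigma> k\<^sub>1
    using assms by (simp add: presentation_section_def presentation_section_axioms_def)
  have "{inv\<^bsub>C\<^esub> (k\<^sub>1 (g, \<omega> r)) \<otimes>\<^bsub>C\<^esub> act (\<iota> r) (inv\<^bsub>\<F>\<^esub> (\<sigma> g)) | g r. g \<in> carrier G \<and> r \<in> R}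
      = {defect g (\<iota> r) | g r. g \<in> carrier G \<and> r \<in> R}"
    by (metis (no_types, opaque_lifting) defect_def boundary_iota)
  then show ?thesis using identities_generated by simp
qed

end
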